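(* Let $(X,d)$ be a compact metric space with a computable structure $\mathcal I$, and let $T:X\to X$ be such that $(X,T)$ is a constructive dynamical system. Let $f:\mathbf N\to\mathbf R$ be monotone with $f(n)\to\infty$, and let $\mathsf d\ge0$ be a real number. Then there is a set $F\subset X$ with $\mathsf d$-dimensional Hausdorff measure $H_{\mathsf d}(F)=0$ such that for every $x\in X\setminus F$ $$K^f(x)\ \ge\ \mathsf d\, R^f(x)$$ (the inequality being asserted whenever the product on the right is not the indeterminate form $0\cdot\infty$).
   Context: All logarithms are in base 2. All indicators below take values in $[-\infty,+\infty]$, with $-\log 0=+\infty$. **Strings and algorithmic information content.** $\Sigma=\{0,1\}^*$ is the set of finite (possibly empty) binary strings, $|s|$ is the length of $s$. Let $c:\Sigma\to\mathbf N$ be the bijection $\emptyset\mapsto0,\ 0\mapsto1,\ 1\mapsto2,\ 00\mapsto3,\ 01\mapsto4,\dots$ (length-lexicographic order). For $s=s_0\dots s_{n-1}$ put $\hat s=s_0s_0s_1s_1\dots s_{n-1}s_{n-1}01$. Let $A_1,A_2,\dots$ be a recursive enumeration of all Turing machines (partial recursive functions $\Sigma\to\Sigma$). A machine $\mathcal U$ is universal if $\mathcal U(\widehat{c^{-1}(m)}\,p)=A_m(p)$ for all $m,p$. A universal machine $\mathcal U$ is fixed once and for all, and $AIC(s)=\min\{|p|:\mathcal U(p)=s\}$. For words over a finite alphabet $\{0,\dots,N-1\}$, $AIC$ is defined in the same way through a fixed computable bijective encoding of such words as elements of $\Sigma$. **Computable structures.** A computable interpretation on a metric space $(X,d)$ is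 a map $I:\Sigma\to X$ with dense image for which there is a total recursive $D:\Sigma\times\Sigma\times\mathbf N\to\mathbf Q$ with $|d(I(s_1),I(s_2))-D(s_1,s_2,n)|\le2^{-n}$ for all $s_1,s_2,n$. Two computable interpretations $I_1,I_2$ are equivalent if there is a total recursive $D^*:\Sigma\times\Sigma\times\mathbf N\to\mathbf Q$ with $|d(I_1(s_1),I_2(s_2))-D^*(s_1,s_2,n)|\le2^{-n}$ for all $s_1,s_2,n$. A computable structure $\mathcal I$ on $X$ is an equivalence class of computable interpretations. **Constructive systems.** $T:X\to X$ is constructive if (i) it is a morphism: $T$ is uniformly continuous and for all $I,J\in\mathcal I$ there is a total recursive $D^*:\Sigma\times\Sigma\times\mathbf N\to\mathbf Q$ with $|d(T(I(s_1)),J(s_2))-D^*(s_1,s_2,n)|\le2^{-n}$ for all $s_1,s_2,n$; and (ii) it is effectively uniformly continuous: there is a total recursive $g:\mathbf N\to\mathbf N$ such that $d(x,y)<2^{-g(n)}$ implies $d(T(x),T(y))<2^{-n}$ for all $x,y,n$. Then $(X,T)$ is called a constructive dynamical system. **Orbit complexity.** For a finite open cover $\beta=\{B_0,\dots,B_{N-1}\}$ of $X$ let $\varphi_\beta(x)=\{\omega\in\{0,\dots,N-1\}^{\mathbf N}:T^n(x)\in B_{\omega(n)}\ \forall n\in\mathbf N\}$, and let $\omega^n$ be the word of the first $n$ digits of $\omega$. Put $$K^f(x,T,\beta)=\limsup_{n\to\infty}\ \min_{\omega\in\varphi_\beta(x)}\frac{AIC(\omega^n)}{f(n)},\qquad K^f(x)=K^f(x,T)=\sup_\beta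 K^f(x,T,\beta),$$ the supremum being over all finite open covers $\beta$ of $X$. **Minimum initial-condition sensitivity.** $B(n,x,\epsilon)=\{y\in X: d(T^i(y),T^i(x))\le\epsilon\ \text{for all}\ 0\le i\le n\}$; $B_R(x)$ is the open ball of center $x$ and radius $R$; $R(x,n,\epsilon)=\inf\{R: B_R(x)\supset B(n,x,\epsilon)\}$; $R^f_\epsilon(x)=\limsup_{n\to\infty}\frac{-\log R(x,n,\epsilon)}{f(n)}$; $R^f(x)=\sup_{\epsilon>0}R^f_\epsilon(x)$. *)

theory Defs
  imports "HOL-Analysis.Analysis" "HOL-Library.Nat_Bijection"
begin

section \<open>Partial recursive functions on the natural numbers\<close>

text \<open>
  Kleene's \<open>\<mu>\<close>-recursive functions. Programs carry no arity: a program applied to argument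
  lists of length \<open>k\<close> computes a \<open>k\<close>-ary partial function, and ill-formed applications
  (such as a projection out of range) are undefined.
\<close>

datatype recf =
    Zero
  | Succ
  | Proj nat
  | Comp recf "recf list"
  | PrimRec recf recf
  | Mu recf

inductive evaluates :: "recf \<Rightarrow> nat list \<Rightarrow> nat \<Rightarrow> bool" where
  eval_Zero: "evaluates Zero xs 0"
| eval_Succ: "evaluates Succ [x] (Suc x)"
| eval_Proj: "i < length xs \<Longrightarrow> evaluates (Proj i) xs (xs ! i)"
| eval_Comp: "list_all2 (\<lambda>g y. evaluates g xs y) gs ys \<Longrightarrow> evaluates h ys z
    \<Longrightarrow> evaluates (Comp h gs) xs z"
| eval_PrimRec_0: "evaluates g xs y \<Longrightarrow> evaluates (PrimRec g h) (0 # xs) y"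
| eval_PrimRec_Suc: "evaluates (PrimRec g h) (n # xs) y \<Longrightarrow> evaluates h (n # y # xs) z
    \<Longrightarrow> evaluates (PrimRec g h) (Suc n # xs) z"
| eval_Mu: "evaluates h (n # xs) 0 \<Longrightarrow> (\<And>i. i < n \<Longrightarrow> \<exists>y. evaluates h (i # xs) (Suc y))
    \<Longrightarrow> evaluates (Mu h) xs n"

definition partial_recursive :: "nat \<Rightarrow> (nat list \<Rightarrow> nat option) \<Rightarrow> bool" where
  "partial_recursive k F \<longleftrightarrow>
     (\<exists>r. \<forall>xs y. length xs = k \<longrightarrow> (evaluates r xs y \<longleftrightarrow> F xs = Some y))"

definition total_recursive_nat :: "(nat \<Rightarrow> nat) \<Rightarrow> bool" where
  "total_recursive_nat g \<longleftrightarrow> partial_recursive 1 (\<lambda>xs. Some (g (xs ! 0)))"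


section \<open>Binary strings and universal machines\<close>

type_synonym str = "bool list"

text \<open>
  \<open>False\<close> is the digit 0 and \<open>True\<close> the digit 1. The length-lexicographic numbering of
  strings is the bijective base-2 numeral with digits 1 and 2, most significant digit first.
\<close>

definition str_code :: "str \<Rightarrow> nat" where
  "str_code s = foldl (\<lambda>k b. 2 * k + (if b then 2 else 1)) 0 s"

lemma str_code_examples:
  "map str_code [[], [False], [True], [False, False], [False, True], [True, False], [True, True]]
     = [0, 1, 2, 3, 4, 5, 6]"
  by (simp add: str_code_def)

lemma str_code_snoc: "str_code (s @ [b]) = 2 * str_code s + (if b then 2 else 1)"
  by (simp add: str_code_def)

lemma bij_str_code: "bij str_code"
proof (rule bijI)
  show "inj str_code"
  proof (rule injI)
    fix s t show "str_code s = str_code t \<Longrightarrow> s = t"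
    proof (induction s arbitrary: t rule: rev_induct)
      case Nil
      then show ?case
        by (cases t rule: rev_cases) (auto simp: str_code_snoc, simp add: str_code_def split: if_splits)
    next
      case (snoc b s)
      show ?case
      proof (cases t rule: rev_cases)
        case Nil
        with snoc.prems show ?thesis
          by (simp add: str_code_snoc, simp add: str_code_def split: if_splits)
      next
        case (snoc t' b')
        with snoc.prems have "2 * str_code s + (if b then 2 else 1) = 2 * str_code t' + (if b' then 2 else 1)"
          by (simp only: str_code_snoc)
        then have "b = b'" "str_code s = str_code t'"
          by (auto split: if_splits) presburger+
        with snoc snoc.IH show ?thesis by simp
      qed
    qed
  qed
  show "surj str_code"
  proof (rule surjI [where f = "\<lambda>n. SOME s. str_code s = n"])
    fix n :: nat
    have "\<exists>s. str_code s = n"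
    proof (induction n rule: less_induct)
      case (less n)
      show ?case
      proof (cases "n = 0")
        case True
        then show ?thesis by (intro exI [of _ "[]"]) (simp add: str_code_def)
      next
        case False
        then have "(n - 1) div 2 < n" by simp
        then obtain s where s: "str_code s = (n - 1) div 2"
          using less.IH by blast
        have "str_code (s @ [even n]) = n"
          unfolding str_code_snoc s using False by simp presburger
        then show ?thesis by blast
      qed
    qed
    then show "str_code (SOME s. str_code s = n) = n" by (rule someI_ex)
  qed
qed

abbreviation str_decode :: "nat \<Rightarrow> str" where
  "str_decode \<equiv> inv str_code"

definition self_delimiting :: "str \<Rightarrow> str" where
  "self_delimiting s = concat (map (\<lambda>b. [b, b]) s) @ [False, True]"

definition machine :: "(str \<Rightarrow> str option) \<Rightarrow> bool" where
  "machine M \<longleftrightarrow> partial_recursive 1 (\<lambda>xs. map_option str_code (M (str_decode (xs ! 0))))"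

text \<open>
  An enumeration \<open>A 1, A 2, \<dots>\<close> of all machines, recursive uniformly in the index;
  the value \<open>A 0\<close> plays no role.
\<close>

definition recursive_enumeration :: "(nat \<Rightarrow> str \<Rightarrow> str option) \<Rightarrow> bool" where
  "recursive_enumeration A \<longleftrightarrow>
     A ` {1..} = Collect machine \<and>
     partial_recursive 2 (\<lambda>xs. map_option str_code (A (Suc (xs ! 0)) (str_decode (xs ! 1))))"

definition universal_machine :: "(nat \<Rightarrow> str \<Rightarrow> str option) \<Rightarrow> (str \<Rightarrow> str option) \<Rightarrow> bool" where
  "universal_machine A U \<longleftrightarrow>
     machine U \<and> (\<forall>m\<ge>1. \<forall>p. U (self_delimiting (str_decode m) @ p) = A m p)"

definition AIC :: "(str \<Rightarrow> str option) \<Rightarrow> str \<Rightarrow> nat" where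
  "AIC U s = (LEAST k. \<exists>p. length p = k \<and> U p = Some s)"

definition words :: "nat \<Rightarrow> nat list set" where
  "words N = {w. set w \<subseteq> {..<N}}"

text \<open>
  Computability of an encoding of words is understood relative to the standard numbering
  \<^const>\<open>list_encode\<close> of lists of natural numbers.
\<close>

definition computable_word_encoding :: "nat \<Rightarrow> (nat list \<Rightarrow> str) \<Rightarrow> bool" where
  "computable_word_encoding N e \<longleftrightarrow>
     bij_betw e (words N) UNIV \<and>
     (\<exists>F. partial_recursive 1 F \<and> (\<forall>w\<in>words N. F [list_encode w] = Some (str_code (e w))))"


section \<open>Computable structures and constructive systems\<close>

definition rat_encode :: "rat \<Rightarrow> nat" where
  "rat_encode q = (case quotient_of q of (a, b) \<Rightarrow> prod_encode (int_encode a, nat b))"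

definition total_recursive_rat :: "(str \<Rightarrow> str \<Rightarrow> nat \<Rightarrow> rat) \<Rightarrow> bool" where
  "total_recursive_rat D \<longleftrightarrow>
     partial_recursive 3
       (\<lambda>xs. Some (rat_encode (D (str_decode (xs ! 0)) (str_decode (xs ! 1)) (xs ! 2))))"

definition computable_real_family :: "(str \<Rightarrow> str \<Rightarrow> real) \<Rightarrow> bool" where
  "computable_real_family \<rho> \<longleftrightarrow>
     (\<exists>D. total_recursive_rat D \<and>
        (\<forall>s1 s2 n. \<bar>\<rho> s1 s2 - of_rat (D s1 s2 n)\<bar> \<le> 1 / 2 ^ n))"

definition computable_interpretation :: "(str \<Rightarrow> 'a::metric_space) \<Rightarrow> bool" where
  "computable_interpretation I \<longleftrightarrow>
     closure (range I) = UNIV \<and> computable_real_family (\<lambda>s1 s2. dist (I s1) (I s2))"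

definition equivalent_interpretations :: "((str \<Rightarrow> 'a::metric_space) \<times> (str \<Rightarrow> 'a)) set" where
  "equivalent_interpretations =
     {(I, J). computable_interpretation I \<and> computable_interpretation J \<and>
        computable_real_family (\<lambda>s1 s2. dist (I s1) (J s2))}"

definition computable_structure :: "(str \<Rightarrow> 'a::metric_space) set \<Rightarrow> bool" where
  "computable_structure \<I> \<longleftrightarrow>
     \<I> \<in> Collect computable_interpretation // equivalent_interpretations"

definition structure_morphism :: "(str \<Rightarrow> 'a::metric_space) set \<Rightarrow> ('a \<Rightarrow> 'a) \<Rightarrow> bool" where
  "structure_morphism \<I> T \<longleftrightarrow>
     uniformly_continuous_on UNIV T \<and>
     (\<forall>I\<in>\<I>. \<forall>J\<in>\<I>. computable_real_family (\<lambda>s1 s2. dist (T (I s1)) (J s2)))"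

definition effectively_uniformly_continuous :: "('a::metric_space \<Rightarrow> 'a) \<Rightarrow> bool" where
  "effectively_uniformly_continuous T \<longleftrightarrow>
     (\<exists>g. total_recursive_nat g \<and>
        (\<forall>x y n. dist x y < 1 / 2 ^ g n \<longrightarrow> dist (T x) (T y) < 1 / 2 ^ n))"

definition constructive :: "(str \<Rightarrow> 'a::metric_space) set \<Rightarrow> ('a \<Rightarrow> 'a) \<Rightarrow> bool" where
  "constructive \<I> T \<longleftrightarrow> structure_morphism \<I> T \<and> effectively_uniformly_continuous T"


section \<open>Orbit complexity\<close>

text \<open>A finite open cover \<open>{B\<^sub>0, \<dots>, B\<^sub>N\<^sub>-\<^sub>1}\<close> with its indexing is the list of its members.\<close>

definition finite_open_cover :: "'a::metric_space set list \<Rightarrow> bool" where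
  "finite_open_cover \<beta> \<longleftrightarrow> (\<forall>B\<in>set \<beta>. open B) \<and> \<Union>(set \<beta>) = UNIV"

definition symbolic_orbits :: "('a \<Rightarrow> 'a) \<Rightarrow> 'a set list \<Rightarrow> 'a \<Rightarrow> (nat \<Rightarrow> nat) set" where
  "symbolic_orbits T \<beta> x = {\<omega>. \<forall>n. \<omega> n < length \<beta> \<and> (T ^^ n) x \<in> \<beta> ! \<omega> n}"

text \<open>
  The infimum over symbolic orbits is a minimum: for each \<open>n\<close> only finitely many words
  \<open>map \<omega> [0..<n]\<close> occur.
\<close>

definition cover_complexity ::
  "(str \<Rightarrow> str option) \<Rightarrow> (nat \<Rightarrow> nat list \<Rightarrow> str) \<Rightarrow> (nat \<Rightarrow> real) \<Rightarrow> ('a \<Rightarrow> 'a)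
     \<Rightarrow> 'a set list \<Rightarrow> 'a \<Rightarrow> ereal" where
  "cover_complexity U enc f T \<beta> x =
     limsup (\<lambda>n. INF \<omega>\<in>symbolic_orbits T \<beta> x.
       ereal (real (AIC U (enc (length \<beta>) (map \<omega> [0..<n])))) / ereal (f n))"

definition orbit_complexity ::
  "(str \<Rightarrow> str option) \<Rightarrow> (nat \<Rightarrow> nat list \<Rightarrow> str) \<Rightarrow> (nat \<Rightarrow> real)
     \<Rightarrow> ('a::metric_space \<Rightarrow> 'a) \<Rightarrow> 'a \<Rightarrow> ereal" where
  "orbit_complexity U enc f T x =
     (SUP \<beta>\<in>Collect finite_open_cover. cover_complexity U enc f T \<beta> x)"


section \<open>Minimum initial-condition sensitivity\<close>

definition orbit_ball :: "('a::metric_space \<Rightarrow> 'a) \<Rightarrow> nat \<Rightarrow> 'a \<Rightarrow> real \<Rightarrow> 'a set" where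
  "orbit_ball T n x \<epsilon> = {y. \<forall>i\<le>n. dist ((T ^^ i) y) ((T ^^ i) x) \<le> \<epsilon>}"

definition orbit_radius :: "('a::metric_space \<Rightarrow> 'a) \<Rightarrow> 'a \<Rightarrow> nat \<Rightarrow> real \<Rightarrow> real" where
  "orbit_radius T x n \<epsilon> = Inf {R. orbit_ball T n x \<epsilon> \<subseteq> ball x R}"

definition neg_log2 :: "real \<Rightarrow> ereal" where
  "neg_log2 r = (if r = 0 then \<infinity> else ereal (- log 2 r))"

definition sensitivity_at ::
  "(nat \<Rightarrow> real) \<Rightarrow> ('a::metric_space \<Rightarrow> 'a) \<Rightarrow> real \<Rightarrow> 'a \<Rightarrow> ereal" where
  "sensitivity_at f T \<epsilon> x = limsup (\<lambda>n. neg_log2 (orbit_radius T x n \<epsilon>) / ereal (f n))"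

definition sensitivity :: "(nat \<Rightarrow> real) \<Rightarrow> ('a::metric_space \<Rightarrow> 'a) \<Rightarrow> 'a \<Rightarrow> ereal" where
  "sensitivity f T x = (SUP \<epsilon>\<in>{0<..}. sensitivity_at f T \<epsilon> x)"


section \<open>Hausdorff measure\<close>

text \<open>
  The case distinction realises the convention that nonempty sets have weight 1 in dimension 0
  (note that \<^term>\<open>0 powr 0 = (0::real)\<close>) and that the empty set has weight 0.
\<close>

definition diameter_weight :: "real \<Rightarrow> 'a::metric_space set \<Rightarrow> ennreal" where
  "diameter_weight d S =
     (if S = {} then 0 else if d = 0 then 1 else ennreal (diameter S powr d))"

text \<open>Boundedness is required since \<^const>\<open>diameter\<close> is unspecified on unbounded sets.\<close>

definition hausdorff_content :: "real \<Rightarrow> real \<Rightarrow> 'a::metric_space set \<Rightarrow> ennreal" where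
  "hausdorff_content d \<delta> F =
     (INF C\<in>{C :: nat \<Rightarrow> 'a set. F \<subseteq> (\<Union>i. C i) \<and> (\<forall>i. bounded (C i) \<and> diameter (C i) \<le> \<delta>)}.
        \<Sum>i. diameter_weight d (C i))"

definition hausdorff_measure :: "real \<Rightarrow> 'a::metric_space set \<Rightarrow> ennreal" where
  "hausdorff_measure d F = (SUP \<delta>\<in>{0<..}. hausdorff_content d \<delta> F)"

end

theory Submission
  imports Defs
begin

text \<open>
  The theorem is a counting argument combined with the Borel--Cantelli lemma for Hausdorff
  measure. Suppose that \<open>K < d * S\<close> at a point \<open>x\<close>, where \<open>K\<close> is the orbit complexity and \<open>S\<close> the
  sensitivity, and choose rationals \<open>a, b\<close> with \<open>K < a < d * b\<close> and \<open>b < S\<close>. Take a cover of \<open>X\<close>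
  whose mesh is small enough for the \<open>\<epsilon>\<close> at which the sensitivity exceeds \<open>b\<close>. Two points with
  a common symbolic word \<open>w\<close> of length \<open>n\<close> stay \<open>\<epsilon>\<close>-close up to time \<open>n\<close>. So the
  cylinder of \<open>w\<close> (the points whose orbit follows \<open>w\<close>) lies in the orbit ball of \<open>x\<close> if \<open>x\<close>
  follows \<open>w\<close>, and for infinitely many \<open>n\<close> it has diameter at most \<open>2 * 2 powr (- b * f n)\<close>. For
  almost all \<open>n\<close> some such word has information content at most \<open>a * f n\<close>
  (\<open>infinite_simple_words\<close>).

  Hence \<open>x\<close> lies in infinitely many cylinders whose \<open>d\<close>-dimensional weight is at most a constant
  times \<open>2 powr (- c * k)\<close>, where \<open>k\<close> is the information content of the word and
  \<open>c = d * b / a > 1\<close>. Index these cylinders by shortest programs. There are only \<open>2\<^sup>k\<close> programs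
  of length \<open>k\<close>, so the total weight converges, and the points that lie in infinitely many
  cylinders form a null set (\<open>hausdorff_measure_simple_words_eq_0\<close>). The exceptional set is the
  union of these null sets over all rational rates and a sequence of covers whose mesh tends to 0.

  The count needs that every string has a program, which holds because the universal machine
  simulates the identity. Dimension \<open>0\<close> is separate: there the weights do not decay, but
  the right-hand side vanishes and complexity is nonnegative.
\<close>

section \<open>Null sets for Hausdorff measures\<close>

lemma hausdorff_measure_eq_0_iff:
  "hausdorff_measure d F = 0 \<longleftrightarrow>
     (\<forall>\<delta>>0. \<forall>\<eta>>0. \<exists>C. F \<subseteq> (\<Union>i::nat. C i) \<and> (\<forall>i. bounded (C i) \<and> diameter (C i) \<le> \<delta>)
        \<and> (\<Sum>i. diameter_weight d (C i)) < ennreal \<eta>)"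
proof -
  have zero: "e = 0 \<longleftrightarrow> (\<forall>\<eta>>0. e < ennreal \<eta>)" for e :: ennreal
  proof
    assume small: "\<forall>\<eta>>0. e < ennreal \<eta>"
    have "e \<le> 0"
    proof (rule ennreal_le_epsilon)
      fix \<eta> :: real assume "\<eta> > 0"
      then show "e \<le> 0 + ennreal \<eta>" using small by (simp add: less_imp_le)
    qed
    then show "e = 0" by simp
  qed auto
  have "hausdorff_measure d F = 0 \<longleftrightarrow> (\<forall>\<delta>>0. hausdorff_content d \<delta> F = 0)"
    unfolding hausdorff_measure_def bot_ennreal[symmetric] SUP_bot_conv by auto
  also have "\<dots> \<longleftrightarrow> (\<forall>\<delta>>0. \<forall>\<eta>>0. hausdorff_content d \<delta> F < ennreal \<eta>)"
    by (subst zero) simp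
  finally show ?thesis
    unfolding hausdorff_content_def INF_less_iff by (simp add: conj_assoc)
qed

lemma hausdorff_measure_UN_eq_0:
  assumes null: "\<And>n::nat. hausdorff_measure d (F n) = 0"
  shows "hausdorff_measure d (\<Union>n. F n) = 0"
  unfolding hausdorff_measure_eq_0_iff
proof (intro allI impI)
  fix \<delta> \<eta> :: real assume \<delta>: "\<delta> > 0" and \<eta>: "\<eta> > 0"
  have "\<exists>C. F n \<subseteq> (\<Union>i::nat. C i) \<and> (\<forall>i. bounded (C i) \<and> diameter (C i) \<le> \<delta>)
      \<and> (\<Sum>i. diameter_weight d (C i)) < ennreal (\<eta> / 2 * (1/2) ^ Suc n)" for n
  proof -
    have "\<eta> / 2 * (1/2) ^ Suc n > 0" using \<eta> by simp
    then show ?thesis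
      using null[of n, unfolded hausdorff_measure_eq_0_iff] \<delta> by blast
  qed
  then obtain C where C: "\<And>n. F n \<subseteq> (\<Union>i::nat. C n i)"
      "\<And>n i. bounded (C n i) \<and> diameter (C n i) \<le> \<delta>"
      "\<And>n. (\<Sum>i. diameter_weight d (C n i)) < ennreal (\<eta> / 2 * (1/2) ^ Suc n)"
    by metis
  define E where "E i = case_prod C (prod_decode i)" for i
  have geometric: "(\<lambda>n. \<eta> / 2 * (1/2) ^ Suc n) sums (\<eta> / 2)"
    using sums_mult[OF power_half_series, of "\<eta> / 2"] by (simp only: mult_1_right)
  have "(\<Sum>i. diameter_weight d (E i)) = (\<Sum>n. \<Sum>i. diameter_weight d (C n i))"
    using suminf_ennreal_2dimen[of "\<lambda>n. \<Sum>i. diameter_weight d (C n i)"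
        "\<lambda>p. diameter_weight d (case_prod C p)"]
    by (simp add: E_def)
  also have "\<dots> \<le> (\<Sum>n. ennreal (\<eta> / 2 * (1/2) ^ Suc n))"
    using C(3) by (intro suminf_le) (auto intro: less_imp_le)
  also have "\<dots> = ennreal (\<Sum>n. \<eta> / 2 * (1/2) ^ Suc n)"
    using \<eta> by (intro suminf_ennreal2 sums_summable[OF geometric]) simp
  also have "\<dots> = ennreal (\<eta> / 2)"
    by (simp only: sums_unique[OF geometric, symmetric])
  also have "\<dots> < ennreal \<eta>" using \<eta> by (simp add: ennreal_less_iff)
  finally have sum: "(\<Sum>i. diameter_weight d (E i)) < ennreal \<eta>" .
  have "(\<Union>n. F n) \<subseteq> (\<Union>i. E i)"
  proof
    fix x assume "x \<in> (\<Union>n. F n)"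
    then obtain n i where "x \<in> C n i" using C(1) by blast
    then have "x \<in> E (prod_encode (n, i))" by (simp add: E_def)
    then show "x \<in> (\<Union>i. E i)" by blast
  qed
  moreover have "bounded (E i) \<and> diameter (E i) \<le> \<delta>" for i
    using C(2) by (simp add: E_def split: prod.split)
  ultimately show "\<exists>E. (\<Union>n. F n) \<subseteq> (\<Union>i::nat. E i)
      \<and> (\<forall>i. bounded (E i) \<and> diameter (E i) \<le> \<delta>) \<and> (\<Sum>i. diameter_weight d (E i)) < ennreal \<eta>"
    using sum by blast
qed

text \<open>
  This is the Borel--Cantelli argument for Hausdorff measure: every tail of the sequence covers
  the set of points that lie in infinitely many members, and the tails of a convergent series
  tend to 0.
\<close>

lemma hausdorff_measure_limsup_eq_0:
  fixes D :: "nat \<Rightarrow> 'a::metric_space set"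
  assumes d: "d > 0" and bdd: "\<And>i. bounded (D i)"
    and summable: "summable (\<lambda>i. diameter (D i) powr d)"
  shows "hausdorff_measure d {x. infinite {i. x \<in> D i}} = 0"
  unfolding hausdorff_measure_eq_0_iff
proof (intro allI impI)
  fix \<delta> \<eta> :: real assume \<delta>: "\<delta> > 0" and \<eta>: "\<eta> > 0"
  have "\<forall>\<^sub>F i in sequentially. diameter (D i) powr d < \<delta> powr d"
    using summable_LIMSEQ_zero[OF summable] \<delta> by (intro order_tendstoD(2)) auto
  then obtain M where M: "\<And>i. i \<ge> M \<Longrightarrow> diameter (D i) powr d < \<delta> powr d"
    unfolding eventually_sequentially by blast
  obtain N where N: "\<And>n. n \<ge> N \<Longrightarrow> norm (\<Sum>i. diameter (D (i + n)) powr d) < \<eta>"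
    using suminf_exist_split[OF \<eta> summable] by blast
  define k where "k = max M N"
  define E where "E i = D (i + k)" for i
  have "diameter (E i) \<le> \<delta>" for i
    using M[of "i + k"] d \<delta> bdd[of "i + k"] unfolding E_def k_def
    by (metis diameter_ge_0 le_add2 max.bounded_iff not_le powr_mono2 less_imp_le)
  moreover have "{x. infinite {i. x \<in> D i}} \<subseteq> (\<Union>i. E i)"
  proof
    fix x assume "x \<in> {x. infinite {i. x \<in> D i}}"
    then obtain i where "i \<ge> k" "x \<in> D i"
      by (auto simp: infinite_nat_iff_unbounded_le)
    then have "x \<in> E (i - k)" by (simp add: E_def)
    then show "x \<in> (\<Union>i. E i)" by blast
  qed
  moreover have "(\<Sum>i. diameter_weight d (E i)) < ennreal \<eta>"
  proof -
    have "(\<Sum>i. diameter_weight d (E i)) = (\<Sum>i. ennreal (diameter (E i) powr d))"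
      using d by (intro arg_cong[where f = suminf]) (auto simp: diameter_weight_def)
    also have "\<dots> = ennreal (\<Sum>i. diameter (E i) powr d)"
      unfolding E_def using summable by (intro suminf_ennreal2) (auto intro: summable_ignore_initial_segment)
    also have "\<dots> < ennreal \<eta>"
      using N[of k] \<eta> by (intro ennreal_lessI) (auto simp: E_def k_def)
    finally show ?thesis .
  qed
  ultimately show "\<exists>E. {x. infinite {i. x \<in> D i}} \<subseteq> (\<Union>i::nat. E i)
      \<and> (\<forall>i. bounded (E i) \<and> diameter (E i) \<le> \<delta>) \<and> (\<Sum>i. diameter_weight d (E i)) < ennreal \<eta>"
    using bdd by (auto simp: E_def)
qed


section \<open>Sets indexed by strings of low information content\<close>

text \<open>
  The identity is a machine, and the universal machine simulates it. Hence the minimum in the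
  definition of \<^const>\<open>AIC\<close> is attained.
\<close>

lemma universal_machine_surj:
  assumes A: "recursive_enumeration A" and U: "universal_machine A U"
  shows "\<exists>p. U p = Some s"
proof -
  have eval: "evaluates (Proj 0) xs y \<longleftrightarrow> y = xs ! 0" if "length xs = 1" for xs y
  proof
    show "evaluates (Proj 0) xs y \<Longrightarrow> y = xs ! 0" by (erule evaluates.cases) auto
    show "y = xs ! 0 \<Longrightarrow> evaluates (Proj 0) xs y" using that by (simp add: eval_Proj)
  qed
  have "str_code (str_decode k) = k" for k
    using bij_is_surj[OF bij_str_code] by (rule surj_f_inv_f)
  then have "machine Some"
    unfolding machine_def partial_recursive_def using eval by (intro exI[of _ "Proj 0"]) auto
  then have "Some \<in> A ` {1..}"
    using A by (simp add: recursive_enumeration_def)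
  then obtain m where "m \<ge> 1" "A m = Some"
    by (metis atLeast_iff imageE)
  then have "U (self_delimiting (str_decode m) @ s) = Some s"
    using U by (simp add: universal_machine_def)
  then show ?thesis ..
qed

lemma str_code_le: "str_code s + 2 \<le> 2 * 2 ^ length s"
  by (induction s rule: rev_induct) (auto simp: str_code_snoc, simp add: str_code_def)

text \<open>
  There are \<open>2\<^sup>k\<close> strings of length \<open>k\<close>, so the sum is a geometric series with ratio
  \<open>2 powr (1 - c)\<close>. The numbering of strings turns it into a series dominated by
  \<open>\<Sum>i. i powr - c\<close>.
\<close>

lemma summable_powr_program_length:
  assumes c: "c > 1"
  shows "summable (\<lambda>i. 2 powr (- c * real (length (str_decode i))))"
proof (rule summable_comparison_test')
  show "summable (\<lambda>i. 2 powr c * of_nat i powr - c)"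
    using c by (intro summable_mult) (simp add: summable_real_powr_iff)
  fix i :: nat assume "i \<ge> 1"
  let ?l = "length (str_decode i)"
  have "str_code (str_decode i) = i"
    using bij_is_surj[OF bij_str_code] by (rule surj_f_inv_f)
  then have "i \<le> 2 * 2 ^ ?l"
    using str_code_le[of "str_decode i"] by linarith
  then have "real i \<le> real (2 * 2 ^ ?l)" by (rule of_nat_mono)
  then have "real i \<le> 2 * 2 ^ ?l" by simp
  also have "\<dots> = 2 powr (1 + ?l)" by (simp add: powr_add powr_realpow)
  finally have dominated: "(2 powr (1 + ?l)) powr - c \<le> of_nat i powr - c"
    using c \<open>i \<ge> 1\<close> by (intro powr_mono2') auto
  have "norm (2 powr (- c * ?l)) = 2 powr c * (2 powr (1 + ?l)) powr - c"
    by (simp add: powr_powr powr_add[symmetric] algebra_simps)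
  also have "\<dots> \<le> 2 powr c * of_nat i powr - c"
    using dominated by (rule mult_left_mono) simp
  finally show "norm (2 powr (- c * ?l)) \<le> 2 powr c * of_nat i powr - c" .
qed

text \<open>
  The sets are reindexed by shortest programs for their codes. Distinct indices have distinct
  programs, so the total weight is at most \<open>M\<close> times a convergent sum over all programs.
\<close>

lemma hausdorff_measure_coded_limsup_eq_0:
  fixes C :: "'w \<Rightarrow> 'a::metric_space set"
  assumes surj: "\<And>s. \<exists>p. U p = Some s" and inj: "inj_on e V"
    and d: "d > 0" and c: "c > 1" and M: "M \<ge> 0"
    and bdd: "\<And>w. w \<in> V \<Longrightarrow> bounded (C w)"
    and small: "\<And>w. w \<in> V \<Longrightarrow> diameter (C w) powr d \<le> M * 2 powr (- c * real (AIC U (e w)))"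
  shows "hausdorff_measure d {x. infinite {w \<in> V. x \<in> C w}} = 0"
proof -
  have "\<exists>p. length p = AIC U s \<and> U p = Some s" for s
    unfolding AIC_def using surj[of s]
    by (intro LeastI_ex[of "\<lambda>k. \<exists>p. length p = k \<and> U p = Some s"]) auto
  then obtain P where P: "\<And>s. length (P s) = AIC U s" "\<And>s. U (P s) = Some s" by metis
  define D where "D i = (\<Union>w\<in>{w \<in> V. str_code (P (e w)) = i}. C w)" for i
  have same_program: "v = w" if v: "v \<in> V" and w: "w \<in> V" and code: "str_code (P (e v)) = str_code (P (e w))"
    for v w
  proof -
    have "P (e v) = P (e w)" using code by (rule injD[OF bij_is_inj[OF bij_str_code]])
    then have "Some (e v) = Some (e w)" by (metis P(2))
    then have "e v = e w" by simp
    then show "v = w" using v w by (rule inj_onD[OF inj])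
  qed
  have inj_prog: "inj_on (\<lambda>w. str_code (P (e w))) V"
    by (rule inj_onI) (rule same_program)
  have D_code: "D (str_code (P (e w))) = C w" if w: "w \<in> V" for w
  proof (rule set_eqI)
    fix x
    show "x \<in> D (str_code (P (e w))) \<longleftrightarrow> x \<in> C w"
      unfolding D_def using w by (auto dest: same_program[OF _ w])
  qed
  have D_cases: "(\<exists>w\<in>V. i = str_code (P (e w)) \<and> D i = C w) \<or> D i = {}" for i
  proof (cases "\<exists>w\<in>V. i = str_code (P (e w))")
    case True
    then show ?thesis by (auto simp: D_code)
  next
    case False
    then have "D i = {}" by (auto simp: D_def)
    then show ?thesis ..
  qed
  have "hausdorff_measure d {x. infinite {i. x \<in> D i}} = 0"
  proof (rule hausdorff_measure_limsup_eq_0[OF d])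
    show "bounded (D i)" for i using D_cases[of i] bdd by auto
    show "summable (\<lambda>i. diameter (D i) powr d)"
    proof (rule summable_comparison_test')
      show "summable (\<lambda>i. M * 2 powr (- c * real (length (str_decode i))))"
        by (intro summable_mult summable_powr_program_length c)
      show "norm (diameter (D i) powr d) \<le> M * 2 powr (- c * real (length (str_decode i)))" for i
        using D_cases[of i]
      proof
        assume "\<exists>w\<in>V. i = str_code (P (e w)) \<and> D i = C w"
        then obtain w where w: "w \<in> V" "i = str_code (P (e w))" "D i = C w" by blast
        then have "length (str_decode i) = AIC U (e w)"
          using P(1) bij_is_inj[OF bij_str_code] by simp
        with small[OF w(1)] w(3) show ?thesis by simp
      next
        assume "D i = {}"
        with M show ?thesis by simp
      qed
    qed
  qed
  moreover have "{x. infinite {i. x \<in> D i}} = {x. infinite {w \<in> V. x \<in> C w}}"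
  proof (intro Collect_cong)
    fix x
    have "{i. x \<in> D i} = (\<lambda>w. str_code (P (e w))) ` {w \<in> V. x \<in> C w}"
      by (auto simp: D_def)
    moreover have "inj_on (\<lambda>w. str_code (P (e w))) {w \<in> V. x \<in> C w}"
      using inj_prog by (rule inj_on_subset) auto
    ultimately show "infinite {i. x \<in> D i} \<longleftrightarrow> infinite {w \<in> V. x \<in> C w}"
      by (simp add: finite_image_iff)
  qed
  ultimately show ?thesis by simp
qed


section \<open>Cylinders of symbolic words\<close>

definition cylinder :: "('a \<Rightarrow> 'a) \<Rightarrow> 'a set list \<Rightarrow> nat list \<Rightarrow> 'a set" where
  "cylinder T \<beta> w = {x. \<forall>i<length w. (T ^^ i) x \<in> \<beta> ! (w ! i)}"

text \<open>
  The words that are simple at rate \<open>a\<close> although their cylinders shrink at rate \<open>b\<close>.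
\<close>

definition simple_words ::
  "(str \<Rightarrow> str option) \<Rightarrow> (nat \<Rightarrow> nat list \<Rightarrow> str) \<Rightarrow> (nat \<Rightarrow> real) \<Rightarrow> ('a::metric_space \<Rightarrow> 'a)
     \<Rightarrow> 'a set list \<Rightarrow> real \<Rightarrow> real \<Rightarrow> nat list set" where
  "simple_words U enc f T \<beta> a b =
     {w \<in> words (length \<beta>). real (AIC U (enc (length \<beta>) w)) \<le> a * f (length w) \<and>
        diameter (cylinder T \<beta> w) \<le> 2 * 2 powr (- b * f (length w))}"

text \<open>
  Eliminating the time scale \<open>f\<close> between the two rates bounds the weight of a cylinder by
  \<open>2 powr (- (d * b / a) * k)\<close>, where \<open>k\<close> is the information content of its word. Since
  \<open>d * b / a > 1\<close>, this beats the number of words of content \<open>k\<close>.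
\<close>

lemma hausdorff_measure_simple_words_eq_0:
  fixes T :: "'a::metric_space \<Rightarrow> 'a"
  assumes surj: "\<And>s. \<exists>p. U p = Some s"
    and inj: "inj_on (enc (length \<beta>)) (words (length \<beta>))"
    and bdd: "bounded (UNIV :: 'a set)"
    and d: "d > 0" and a: "a > 0" and ab: "a < d * b"
  shows "hausdorff_measure d {x. infinite {w \<in> simple_words U enc f T \<beta> a b. x \<in> cylinder T \<beta> w}} = 0"
proof (rule hausdorff_measure_coded_limsup_eq_0[OF surj _ d, where c = "d * b / a" and M = "2 powr d"])
  show "inj_on (enc (length \<beta>)) (simple_words U enc f T \<beta> a b)"
    using inj by (rule inj_on_subset) (auto simp: simple_words_def)
  show "d * b / a > 1" using a ab by simp
  show bdd_cyl: "bounded (cylinder T \<beta> w)" for w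
    using bdd by (rule bounded_subset) auto
  fix w assume w: "w \<in> simple_words U enc f T \<beta> a b"
  let ?k = "real (AIC U (enc (length \<beta>) w))" and ?t = "f (length w)"
  have diam: "diameter (cylinder T \<beta> w) \<le> 2 * 2 powr (- b * ?t)" and k: "?k \<le> a * ?t"
    using w by (auto simp: simple_words_def)
  have "d * b > 0" using a ab by linarith
  then have "d * b * (?k / a) \<le> d * b * ?t"
    using a k by (intro mult_left_mono) (auto simp: field_simps)
  then have exponent: "- b * ?t * d \<le> - (d * b / a) * ?k" by (simp add: mult_ac)
  have "diameter (cylinder T \<beta> w) powr d \<le> (2 * 2 powr (- b * ?t)) powr d"
    using diam d bdd_cyl by (intro powr_mono2) (auto intro: diameter_ge_0)
  also have "\<dots> = 2 powr d * 2 powr (- b * ?t * d)"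
    by (simp add: powr_mult powr_powr)
  also have "\<dots> \<le> 2 powr d * 2 powr (- (d * b / a) * ?k)"
    using exponent by (intro mult_left_mono powr_mono) auto
  finally show "diameter (cylinder T \<beta> w) powr d \<le> 2 powr d * 2 powr (- (d * b / a) * ?k)" .
qed simp

text \<open>
  A word of length \<open>n\<close> controls the times \<open>0, \<dots>, n - 1\<close>, whereas the orbit ball also looks at
  time \<open>n\<close>. The modulus of continuity of \<open>T\<close> supplies this last time, so the growth of \<open>f\<close>
  between consecutive times does not matter.
\<close>

lemma cylinder_subset_orbit_ball:
  assumes w: "w \<in> words (length \<beta>)" "w \<noteq> []" and x: "x \<in> cylinder T \<beta> w"
    and mesh: "\<And>B y z. B \<in> set \<beta> \<Longrightarrow> y \<in> B \<Longrightarrow> z \<in> B \<Longrightarrow> dist y z < \<rho>"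
    and \<rho>: "\<rho> \<le> \<epsilon>" and modulus: "\<And>y z. dist y z < \<rho> \<Longrightarrow> dist (T y) (T z) \<le> \<epsilon>"
  shows "cylinder T \<beta> w \<subseteq> orbit_ball T (length w) x \<epsilon>"
proof
  fix y assume y: "y \<in> cylinder T \<beta> w"
  have close: "dist ((T ^^ i) y) ((T ^^ i) x) < \<rho>" if "i < length w" for i
  proof -
    have "w ! i < length \<beta>" using w(1) that nth_mem by (fastforce simp: words_def)
    then show ?thesis
      using x y that by (intro mesh[OF nth_mem]) (auto simp: cylinder_def)
  qed
  have "dist ((T ^^ i) y) ((T ^^ i) x) \<le> \<epsilon>" if i: "i \<le> length w" for i
  proof (cases "i = length w")
    case False
    then show ?thesis using close[of i] \<rho> i by simp
  next
    case True
    then obtain j where "i = Suc j" "j < length w" using w(2) by (cases w) auto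
    then show ?thesis using modulus[OF close] by simp
  qed
  then show "y \<in> orbit_ball T (length w) x \<epsilon>" by (simp add: orbit_ball_def)
qed

lemma diameter_le_twice_radius:
  assumes "S \<subseteq> ball x R" and "R \<ge> 0"
  shows "diameter S \<le> 2 * R"
proof (cases "S = {}")
  case False
  have "dist y z \<le> 2 * R" if "y \<in> S" "z \<in> S" for y z
    using dist_triangle3[of y z x] subsetD[OF assms(1) that(1)] subsetD[OF assms(1) that(2)] by simp
  with False show ?thesis
    unfolding diameter_def by (auto intro!: cSUP_least)
qed (use assms in simp)

lemma orbit_ball_subset_ball_if_neg_log2:
  fixes T :: "'a::metric_space \<Rightarrow> 'a"
  assumes bdd: "bounded (UNIV :: 'a set)" and \<epsilon>: "\<epsilon> \<ge> 0"
    and less: "ereal t < neg_log2 (orbit_radius T x n \<epsilon>)"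
  obtains R where "0 < R" "R < 2 powr (- t)" "orbit_ball T n x \<epsilon> \<subseteq> ball x R"
proof -
  let ?S = "{R. orbit_ball T n x \<epsilon> \<subseteq> ball x R}"
  have "x \<in> orbit_ball T n x \<epsilon>" using \<epsilon> by (simp add: orbit_ball_def)
  then have pos: "R > 0" if "R \<in> ?S" for R
    using that by (metis (mono_tags) centre_in_ball mem_Collect_eq subsetD)
  obtain R0 where "UNIV \<subseteq> ball x R0"
    using bdd bounded_subset_ballD by blast
  then have ne: "?S \<noteq> {}" by auto
  have "bdd_below ?S" using pos by (intro bdd_belowI[of _ 0]) (auto intro: less_imp_le)
  have "Inf ?S < 2 powr (- t)"
  proof (cases "Inf ?S = 0")
    case False
    have "Inf ?S \<ge> 0" using ne pos by (intro cInf_greatest) (auto intro: less_imp_le)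
    with False have "Inf ?S > 0" by simp
    moreover have "log 2 (Inf ?S) < - t"
      using less False by (simp add: neg_log2_def orbit_radius_def)
    ultimately show ?thesis by (simp add: log_less_iff)
  qed simp
  then obtain R where "R \<in> ?S" "R < 2 powr (- t)"
    using cInf_lessD[OF ne] by blast
  with pos show ?thesis by (intro that[of R]) auto
qed

text \<open>
  Low complexity is an upper bound on a limit superior and provides simple words at almost all
  times; sensitivity is a lower bound on a limit superior and makes their cylinders small at
  infinitely many times. So both happen together infinitely often. The words obtained have
  different lengths, hence there are infinitely many of them.
\<close>

lemma infinite_simple_words:
  fixes T :: "'a::metric_space \<Rightarrow> 'a"
  assumes bdd: "bounded (UNIV :: 'a set)" and f: "filterlim f at_top sequentially"
    and mesh: "\<And>B y z. B \<in> set \<beta> \<Longrightarrow> y \<in> B \<Longrightarrow> z \<in> B \<Longrightarrow> dist y z < \<rho>"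
    and \<rho>: "\<rho> \<le> \<epsilon>" and modulus: "\<And>y z. dist y z < \<rho> \<Longrightarrow> dist (T y) (T z) \<le> \<epsilon>"
    and \<epsilon>: "\<epsilon> > 0"
    and complexity: "cover_complexity U enc f T \<beta> x < ereal a"
    and sens: "ereal b < sensitivity_at f T \<epsilon> x"
  shows "infinite {w \<in> simple_words U enc f T \<beta> a b. x \<in> cylinder T \<beta> w}"
proof -
  let ?W = "{w \<in> simple_words U enc f T \<beta> a b. x \<in> cylinder T \<beta> w}"
  let ?A = "\<lambda>n. INF \<omega>\<in>symbolic_orbits T \<beta> x.
       ereal (real (AIC U (enc (length \<beta>) (map \<omega> [0..<n])))) / ereal (f n)"
  have "\<forall>\<^sub>F n in sequentially. ?A n < ereal a"
    using complexity unfolding cover_complexity_def by (rule Limsup_lessD)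
  moreover have "\<forall>\<^sub>F n in sequentially. f n > 0"
    using f by (simp add: filterlim_at_top_dense)
  ultimately have ev: "\<forall>\<^sub>F n in sequentially. ?A n < ereal a \<and> f n > 0 \<and> n > 0"
    using eventually_gt_at_top[of 0] by eventually_elim simp
  have "\<not> (\<forall>\<^sub>F n in sequentially. neg_log2 (orbit_radius T x n \<epsilon>) / ereal (f n) \<le> ereal b)"
    using sens Limsup_bounded unfolding sensitivity_at_def by (metis not_le)
  then have "\<exists>\<^sub>F n in sequentially. ereal b < neg_log2 (orbit_radius T x n \<epsilon>) / ereal (f n)"
    by (simp add: frequently_def not_less)
  then have "\<exists>\<^sub>F n in sequentially. (?A n < ereal a \<and> f n > 0 \<and> n > 0)
      \<and> ereal b < neg_log2 (orbit_radius T x n \<epsilon>) / ereal (f n)"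
    using ev by (rule frequently_eventually_conj)
  then have "\<exists>\<^sub>F n in sequentially. n \<in> length ` ?W"
  proof (rule frequently_elim1)
    fix n
    assume "(?A n < ereal a \<and> f n > 0 \<and> n > 0)
      \<and> ereal b < neg_log2 (orbit_radius T x n \<epsilon>) / ereal (f n)"
    then have A: "?A n < ereal a" and fn: "f n > 0" and n: "n > 0"
      and s: "ereal b < neg_log2 (orbit_radius T x n \<epsilon>) / ereal (f n)" by auto
    obtain \<omega> where \<omega>: "\<omega> \<in> symbolic_orbits T \<beta> x"
        "ereal (real (AIC U (enc (length \<beta>) (map \<omega> [0..<n])))) / ereal (f n) < ereal a"
      using A unfolding INF_less_iff by blast
    define w where "w = map \<omega> [0..<n]"
    have w: "length w = n" "w \<in> words (length \<beta>)" "x \<in> cylinder T \<beta> w"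
      using \<omega>(1) by (auto simp: w_def words_def cylinder_def symbolic_orbits_def)
    have "real (AIC U (enc (length \<beta>) w)) \<le> a * f n"
      using \<omega>(2) fn by (simp add: w_def field_simps)
    moreover have "diameter (cylinder T \<beta> w) \<le> 2 * 2 powr (- b * f n)"
    proof -
      have "ereal (b * f n) < neg_log2 (orbit_radius T x n \<epsilon>)"
        using s fn ereal_less_divide_pos[of "ereal (f n)" "ereal b"] by (simp add: mult.commute)
      then obtain R where R: "0 < R" "R < 2 powr - (b * f n)" "orbit_ball T n x \<epsilon> \<subseteq> ball x R"
        using orbit_ball_subset_ball_if_neg_log2[OF bdd] \<epsilon> by (metis less_imp_le)
      have "w \<noteq> []" using w(1) n by auto
      then have "cylinder T \<beta> w \<subseteq> orbit_ball T (length w) x \<epsilon>"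
        using w mesh \<rho> modulus by (intro cylinder_subset_orbit_ball) blast+
      then have "cylinder T \<beta> w \<subseteq> ball x R" using w(1) R(3) by simp
      then have "diameter (cylinder T \<beta> w) \<le> 2 * R"
        using R(1) by (intro diameter_le_twice_radius) auto
      with R(2) show ?thesis by simp
    qed
    ultimately have "w \<in> ?W" using w by (simp add: simple_words_def)
    then show "n \<in> length ` ?W" using w(1) by blast
  qed
  then have "infinite {n. n \<in> length ` ?W}"
    by (simp add: cofinite_eq_sequentially[symmetric] frequently_cofinite)
  then show ?thesis using finite_imageI by auto
qed


section \<open>Complexity bounds sensitivity almost everywhere\<close>

lemma compact_finite_open_cover:
  assumes "compact (UNIV :: 'a::metric_space set)" and "\<rho> > 0"
  obtains \<beta> :: "'a::metric_space set list" where "finite_open_cover \<beta>"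
    and "\<And>B y z. B \<in> set \<beta> \<Longrightarrow> y \<in> B \<Longrightarrow> z \<in> B \<Longrightarrow> dist y z < \<rho>"
proof -
  have "\<exists>k. finite k \<and> UNIV \<subseteq> (\<Union>x\<in>k. ball (x::'a) (\<rho> / 2))"
    using assms unfolding compact_eq_totally_bounded by (metis half_gt_zero)
  then obtain k :: "'a set" where k: "finite k" "UNIV \<subseteq> (\<Union>x\<in>k. ball x (\<rho> / 2))" by blast
  obtain xs where xs: "set xs = k" using finite_list[OF k(1)] by blast
  show ?thesis
  proof (rule that[of "map (\<lambda>x. ball x (\<rho> / 2)) xs"])
    show "finite_open_cover (map (\<lambda>x. ball x (\<rho> / 2)) xs)"
      using k(2) xs by (auto simp: finite_open_cover_def)
    fix B y z assume "B \<in> set (map (\<lambda>x. ball x (\<rho> / 2)) xs)" "y \<in> B" "z \<in> B"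
    then show "dist y z < \<rho>"
      using dist_triangle_half_r by (auto simp: mem_ball)
  qed
qed

lemma orbit_complexity_nonneg:
  fixes T :: "'a::metric_space \<Rightarrow> 'a"
  assumes "filterlim f at_top sequentially"
  shows "orbit_complexity U enc f T x \<ge> 0"
proof -
  have "\<forall>\<^sub>F n in sequentially. f n > 0"
    using assms by (simp add: filterlim_at_top_dense)
  then have "cover_complexity U enc f T [UNIV] x \<ge> 0"
    unfolding cover_complexity_def
    by (intro le_Limsup) (auto elim!: eventually_mono intro!: INF_greatest)
  moreover have "finite_open_cover [UNIV :: 'a set]" by (simp add: finite_open_cover_def)
  ultimately show ?thesis
    unfolding orbit_complexity_def by (meson SUP_upper2 mem_Collect_eq)
qed

text \<open>
  Rational rates leave only countably many null sets to unite.
\<close>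

lemma obtain_rational_rates:
  fixes K S :: ereal
  assumes "0 \<le> K" and "d > 0" and "K < ereal d * S"
  obtains a b :: rat where "of_rat a > (0::real)" "of_rat a < d * of_rat b"
    "K < ereal (of_rat a)" "ereal (of_rat b) < S"
proof -
  have dense: "\<exists>q :: rat. u < ereal (of_rat q) \<and> ereal (of_rat q) < v" if uv: "u < v" for u v :: ereal
  proof -
    obtain r where r: "u < ereal r" "ereal r < v" using ereal_dense2[OF uv] by blast
    obtain s where s: "r < s" "ereal s < v"
      using ereal_dense2[OF r(2)] by auto
    obtain q :: rat where "r < of_rat q" "of_rat q < s" using of_rat_dense[OF s(1)] by blast
    then show ?thesis using r s by (meson ereal_less_eq less_ereal.simps(1) less_trans)
  qed
  obtain a :: rat where a: "K < ereal (of_rat a)" "ereal (of_rat a) < ereal d * S"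
    using dense[OF assms(3)] by blast
  have "ereal (of_rat a / d) < S"
    using a(2) assms(2) by (cases S) (auto simp: field_simps)
  then obtain b :: rat where b: "ereal (of_rat a / d) < ereal (of_rat b)" "ereal (of_rat b) < S"
    using dense by blast
  show ?thesis
  proof (rule that[OF _ _ a(1) b(2)])
    show "of_rat a > (0::real)" using a(1) assms(1) by (metis ereal_less(2) le_less_trans)
    show "of_rat a < d * (of_rat b :: real)" using b(1) assms(2) by (simp add: field_simps)
  qed
qed

theorem theorem41:
  fixes A :: "nat \<Rightarrow> str \<Rightarrow> str option"
    and U :: "str \<Rightarrow> str option"
    and enc :: "nat \<Rightarrow> nat list \<Rightarrow> str"
    and \<I> :: "(str \<Rightarrow> 'a::metric_space) set"
    and T :: "'a \<Rightarrow> 'a"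
    and f :: "nat \<Rightarrow> real"
    and d :: real
  assumes "recursive_enumeration A"
    and "universal_machine A U"
    and "\<And>N. N \<ge> 1 \<Longrightarrow> computable_word_encoding N (enc N)"
    and "compact (UNIV :: 'a set)"
    and "computable_structure \<I>"
    and "constructive \<I> T"
    and "mono f"
    and "filterlim f at_top sequentially"
    and "d \<ge> 0"
  shows "\<exists>F :: 'a set. hausdorff_measure d F = 0 \<and>
           (\<forall>x\<in>UNIV - F. \<not> (d = 0 \<and> sensitivity f T x = \<infinity>) \<longrightarrow>
              orbit_complexity U enc f T x \<ge> ereal d * sensitivity f T x)"
proof (cases "d = 0")
  case True
  have "hausdorff_measure d ({} :: 'a set) = 0"
    using hausdorff_measure_eq_0_iff[of d "{} :: 'a set"]
    by (auto intro!: exI[of _ "\<lambda>_. {}"] simp: diameter_weight_def)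
  moreover have "orbit_complexity U enc f T x \<ge> ereal d * sensitivity f T x" for x
    using True orbit_complexity_nonneg[OF assms(8), of U enc T x]
    by (simp add: zero_ereal_def[symmetric])
  ultimately show ?thesis using True by (intro exI[of _ "{}"]) auto
next
  case False
  with \<open>d \<ge> 0\<close> have d: "d > 0" by simp
  have bdd: "bounded (UNIV :: 'a set)" using assms(4) by (rule compact_imp_bounded)
  have "\<exists>\<beta> :: 'a set list. finite_open_cover \<beta> \<and>
      (\<forall>B\<in>set \<beta>. \<forall>y\<in>B. \<forall>z\<in>B. dist y z < 1 / Suc m)" for m :: nat
    using compact_finite_open_cover[OF assms(4), of "1 / Suc m"] by (metis of_nat_0_less_iff zero_less_Suc zero_less_divide_1_iff)
  then obtain \<beta> :: "nat \<Rightarrow> 'a set list" where cover: "\<And>m. finite_open_cover (\<beta> m)"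
    and mesh: "\<And>m B y z. B \<in> set (\<beta> m) \<Longrightarrow> y \<in> B \<Longrightarrow> z \<in> B \<Longrightarrow> dist y z < 1 / Suc m"
    by metis
  define G where "G = (\<lambda>(m, a :: rat, b :: rat).
      {x. 0 < (of_rat a :: real) \<and> of_rat a < d * of_rat b \<and>
         infinite {w \<in> simple_words U enc f T (\<beta> m) (of_rat a) (of_rat b). x \<in> cylinder T (\<beta> m) w}})"
  have null: "hausdorff_measure d (G i) = 0" for i
  proof -
    obtain m a b where i: "i = (m, a, b)" by (cases i) auto
    have "length (\<beta> m) \<ge> 1"
      using cover[of m] by (cases "\<beta> m") (auto simp: finite_open_cover_def)
    then have inj: "inj_on (enc (length (\<beta> m))) (words (length (\<beta> m)))"
      using assms(3) by (auto simp: computable_word_encoding_def bij_betw_def)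
    show ?thesis
    proof (cases "0 < (of_rat a :: real) \<and> of_rat a < d * of_rat b")
      case True
      then show ?thesis
        using hausdorff_measure_simple_words_eq_0[where T = T and f = f and enc = enc and \<beta> = "\<beta> m",
            OF universal_machine_surj[OF assms(1,2)] inj bdd d, of "of_rat a" "of_rat b"]
        by (simp add: G_def i)
    next
      case False
      then have "G i = {x. infinite {j :: nat. x \<in> {}}}" by (auto simp: G_def i)
      then show ?thesis using hausdorff_measure_limsup_eq_0[OF d, of "\<lambda>_. {}"] by simp
    qed
  qed
  define F where "F = (\<Union>j. G (from_nat j))"
  have "hausdorff_measure d F = 0"
    unfolding F_def using null by (rule hausdorff_measure_UN_eq_0)
  moreover have "ereal d * sensitivity f T x \<le> orbit_complexity U enc f T x" if x: "x \<notin> F" for x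
  proof (rule ccontr)
    assume "\<not> ereal d * sensitivity f T x \<le> orbit_complexity U enc f T x"
    then have "orbit_complexity U enc f T x < ereal d * sensitivity f T x" by simp
    then obtain a b :: rat where ab: "of_rat a > (0::real)" "of_rat a < d * of_rat b"
        "orbit_complexity U enc f T x < ereal (of_rat a)" "ereal (of_rat b) < sensitivity f T x"
      using obtain_rational_rates[OF orbit_complexity_nonneg[OF assms(8)] d] by metis
    obtain \<epsilon> where \<epsilon>: "\<epsilon> > 0" "ereal (of_rat b) < sensitivity_at f T \<epsilon> x"
      using ab(4) unfolding sensitivity_def less_SUP_iff by auto
    have "uniformly_continuous_on UNIV T"
      using assms(6) by (simp add: constructive_def structure_morphism_def)
    then obtain \<delta> where \<delta>: "\<delta> > 0" "\<And>y z. dist y z < \<delta> \<Longrightarrow> dist (T y) (T z) < \<epsilon>"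
      using \<epsilon>(1) unfolding uniformly_continuous_on_def by (metis UNIV_I)
    \<comment> \<open>The cover must be finer than \<open>\<delta>\<close> for the last time, and than \<open>\<epsilon>\<close> for the others.\<close>
    obtain m where m: "1 / Suc m < min \<delta> \<epsilon>"
      using reals_Archimedean[of "min \<delta> \<epsilon>"] \<delta>(1) \<epsilon>(1) by (auto simp: inverse_eq_divide)
    have "cover_complexity U enc f T (\<beta> m) x \<le> orbit_complexity U enc f T x"
      unfolding orbit_complexity_def using cover by (intro SUP_upper) simp
    then have "cover_complexity U enc f T (\<beta> m) x < ereal (of_rat a)"
      using ab(3) by (rule le_less_trans)
    moreover have "dist (T y) (T z) \<le> \<epsilon>" if "dist y z < 1 / Suc m" for y z
      using \<delta>(2)[of y z] that m by simp
    ultimately have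
      "infinite {w \<in> simple_words U enc f T (\<beta> m) (of_rat a) (of_rat b). x \<in> cylinder T (\<beta> m) w}"
      using m \<epsilon> mesh by (intro infinite_simple_words[OF bdd assms(8), of _ "1 / Suc m" \<epsilon>]) auto
    then have "x \<in> G (m, a, b)" using ab(1,2) by (simp add: G_def)
    then have "x \<in> F" unfolding F_def by (metis UNIV_I UN_I from_nat_to_nat)
    with x show False ..
  qed
  ultimately show ?thesis by blast
qed

end
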